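(* Every weakly proper Hadamard space $(H,d)$ is Hausdorff with respect to the weak topology $\tau_w$.
   Context: A Hadamard space is a complete $\mathrm{CAT}(0)$ space. For $x\in H$, $\Gamma_x(H)$ is the set of all constant speed geodesics $\gamma:[0,1]\to H$ (i.e. $d(\gamma(s),\gamma(t))=|s-t|\,d(\gamma(0),\gamma(1))$ for all $s,t\in[0,1]$) with $\gamma(0)=x$. For a geodesic $\gamma$, $P_\gamma$ denotes the metric projection onto (the image of) $\gamma$. Elementary sets: for $x\in H$, $\gamma\in\Gamma_x(H)$, $\varepsilon>0$, $U_x(\varepsilon;\gamma):=\{y\in H: d(x,P_\gamma y)<\varepsilon\}$; also $U_x(\varepsilon;\gamma_1,\dots,\gamma_n):=\bigcap_{i=1}^n U_x(\varepsilon;\gamma_i)$. Weak topology $\tau_w$: a set $U\subset H$ is weakly open if for every $x\in U$ there exist $\varepsilon>0$ and finitely many $\gamma_1,\dots,\gamma_n\in\Gamma_x(H)$ with $U_x(\varepsilon;\gamma_1,\dots,\gamma_n)\subseteq U$. The weakly open sets (together with $\emptyset$) form the topology $\tau_w$ on $H$. $H$ is weakly proper if for every $x\in H$, every $\gamma\in\Gamma_x(H)$ and every $\varepsilon>0$ there exists $V\in\tau_w$ with $x\in V\subseteq U_x(\varepsilon;\gamma)$. *)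

theory Defs
  imports "HOL-Analysis.Analysis"
begin

context Metric_space
begin

text \<open>Geodesics are functions on all of \<^typ>\<open>real\<close>; only their values on \<open>[0,1]\<close> are relevant.\<close>

definition geodesic :: "(real \<Rightarrow> 'a) \<Rightarrow> bool" where
  "geodesic \<gamma> \<longleftrightarrow> \<gamma> \<in> {0..1} \<rightarrow> M \<and>
     (\<forall>s\<in>{0..1}. \<forall>t\<in>{0..1}. d (\<gamma> s) (\<gamma> t) = \<bar>s - t\<bar> * d (\<gamma> 0) (\<gamma> 1))"

definition geodesics_from :: "'a \<Rightarrow> (real \<Rightarrow> 'a) set" where
  "geodesics_from x = {\<gamma>. geodesic \<gamma> \<and> \<gamma> 0 = x}"

definition joins :: "(real \<Rightarrow> 'a) \<Rightarrow> 'a \<Rightarrow> 'a \<Rightarrow> bool" where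
  "joins \<gamma> p q \<longleftrightarrow> geodesic \<gamma> \<and> \<gamma> 0 = p \<and> \<gamma> 1 = q"

text \<open>Every two points are joined by a geodesic, and every geodesic triangle with sides
  \<open>\<alpha>\<close>, \<open>\<beta>\<close>, \<open>\<gamma>\<close> is at most as thick as its Euclidean comparison triangle
  \<open>p'\<close>, \<open>q'\<close>, \<open>r'\<close>: since geodesics have constant speed, the comparison point of
  \<open>\<sigma> s\<close> is the point with the same parameter on the corresponding Euclidean side.\<close>

definition cat0 :: bool where
  "cat0 \<longleftrightarrow>
     (\<forall>p\<in>M. \<forall>q\<in>M. \<exists>\<gamma>. joins \<gamma> p q) \<and>
     (\<forall>p\<in>M. \<forall>q\<in>M. \<forall>r\<in>M. \<forall>\<alpha> \<beta> \<gamma>. \<forall>p' q' r' :: real ^ 2.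
        joins \<alpha> p q \<and> joins \<beta> q r \<and> joins \<gamma> r p \<and>
        dist p' q' = d p q \<and> dist q' r' = d q r \<and> dist r' p' = d r p \<longrightarrow>
        (let sides = {(\<alpha>, p', q'), (\<beta>, q', r'), (\<gamma>, r', p')} in
          \<forall>(\<sigma>, a, b)\<in>sides. \<forall>(\<tau>, c, e)\<in>sides. \<forall>s\<in>{0..1}. \<forall>t\<in>{0..1}.
            d (\<sigma> s) (\<tau> t) \<le> dist (linepath a b s) (linepath c e t)))"

text \<open>In a complete CAT(0) space the nearest point on a geodesic exists and is unique.\<close>

definition geodesic_proj :: "(real \<Rightarrow> 'a) \<Rightarrow> 'a \<Rightarrow> 'a" where
  "geodesic_proj \<gamma> y = (THE z. is_arg_min (d y) (\<lambda>w. w \<in> \<gamma> ` {0..1}) z)"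

definition elementary_set :: "'a \<Rightarrow> real \<Rightarrow> (real \<Rightarrow> 'a) \<Rightarrow> 'a set" where
  "elementary_set x \<epsilon> \<gamma> = {y \<in> M. d x (geodesic_proj \<gamma> y) < \<epsilon>}"

text \<open>The intersection with \<^term>\<open>M\<close> only matters for the empty family \<open>\<Gamma>\<close>.\<close>

definition weakly_open :: "'a set \<Rightarrow> bool" where
  "weakly_open U \<longleftrightarrow> U \<subseteq> M \<and>
     (\<forall>x\<in>U. \<exists>\<epsilon>>0. \<exists>\<Gamma>. finite \<Gamma> \<and> \<Gamma> \<subseteq> geodesics_from x \<and>
        M \<inter> (\<Inter>\<gamma>\<in>\<Gamma>. elementary_set x \<epsilon> \<gamma>) \<subseteq> U)"

definition weak_topology :: "'a topology" where
  "weak_topology = topology weakly_open"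

lemma istopology_weakly_open: "istopology weakly_open"
  unfolding istopology_def
proof (intro conjI allI impI)
  fix S T assume S: "weakly_open S" and T: "weakly_open T"
  show "weakly_open (S \<inter> T)"
    unfolding weakly_open_def
  proof (intro conjI ballI)
    show "S \<inter> T \<subseteq> M" using S by (auto simp: weakly_open_def)
    fix x assume x: "x \<in> S \<inter> T"
    obtain e F where e: "e > 0" "finite F" "F \<subseteq> geodesics_from x"
      "M \<inter> (\<Inter>\<gamma>\<in>F. elementary_set x e \<gamma>) \<subseteq> S"
      using S x unfolding weakly_open_def by (meson IntD1)
    obtain e' F' where e': "e' > 0" "finite F'" "F' \<subseteq> geodesics_from x"
      "M \<inter> (\<Inter>\<gamma>\<in>F'. elementary_set x e' \<gamma>) \<subseteq> T"
      using T x unfolding weakly_open_def by (meson IntD2)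
    have "M \<inter> (\<Inter>\<gamma>\<in>F \<union> F'. elementary_set x (min e e') \<gamma>) \<subseteq> S \<inter> T"
      using e(4) e'(4) by (fastforce simp: elementary_set_def)
    with e e' show "\<exists>\<epsilon>>0. \<exists>\<Gamma>. finite \<Gamma> \<and> \<Gamma> \<subseteq> geodesics_from x \<and>
        M \<inter> (\<Inter>\<gamma>\<in>\<Gamma>. elementary_set x \<epsilon> \<gamma>) \<subseteq> S \<inter> T"
      by (intro exI[of _ "min e e'"] conjI exI[of _ "F \<union> F'"]) auto
  qed
next
  fix \<K> assume K: "\<forall>K\<in>\<K>. weakly_open K"
  show "weakly_open (\<Union>\<K>)"
    unfolding weakly_open_def
  proof (intro conjI ballI)
    show "\<Union>\<K> \<subseteq> M" using K by (auto simp: weakly_open_def)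
    fix x assume "x \<in> \<Union>\<K>"
    then obtain K where "K \<in> \<K>" "x \<in> K" by blast
    with K obtain e F where "e > 0" "finite F" "F \<subseteq> geodesics_from x"
      "M \<inter> (\<Inter>\<gamma>\<in>F. elementary_set x e \<gamma>) \<subseteq> K"
      unfolding weakly_open_def by meson
    with \<open>K \<in> \<K>\<close> show "\<exists>\<epsilon>>0. \<exists>\<Gamma>. finite \<Gamma> \<and> \<Gamma> \<subseteq> geodesics_from x \<and>
        M \<inter> (\<Inter>\<gamma>\<in>\<Gamma>. elementary_set x \<epsilon> \<gamma>) \<subseteq> \<Union>\<K>"
      by (meson Sup_upper order_trans)
  qed
qed

lemma openin_weak_topology: "openin weak_topology = weakly_open"
  by (simp add: weak_topology_def istopology_weakly_open topology_inverse')

lemma topspace_weak_topology: "topspace weak_topology = M"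
proof
  show "topspace weak_topology \<subseteq> M"
    by (auto simp: topspace_def openin_weak_topology weakly_open_def)
  have "weakly_open M"
    unfolding weakly_open_def by (intro conjI ballI exI[of _ 1] exI[of _ "{}"]) auto
  then show "M \<subseteq> topspace weak_topology"
    by (simp add: openin_subset openin_weak_topology)
qed

definition weakly_proper :: bool where
  "weakly_proper \<longleftrightarrow>
     (\<forall>x\<in>M. \<forall>\<gamma>\<in>geodesics_from x. \<forall>\<epsilon>>0.
        \<exists>V. openin weak_topology V \<and> x \<in> V \<and> V \<subseteq> elementary_set x \<epsilon> \<gamma>)"

end

locale Hadamard_space = Metric_space +
  assumes mcomplete: mcomplete
    and cat0: cat0

end

theory Submission
  imports Defs
begin

text \<open>
  Two distinct points \<open>x\<close> and \<open>y\<close> are separated by the projection onto a geodesic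
  \<open>\<gamma>\<close> joining them. The projection depends only on the image of \<open>\<gamma>\<close>, so it is the
  same for \<open>\<gamma>\<close> and for the reversed geodesic, which starts at \<open>y\<close>. With
  \<open>\<epsilon> = d x y / 2\<close>, a point \<open>z\<close> lying in the elementary sets of both \<open>x\<close> and
  \<open>y\<close> would have a projection closer than \<open>\<epsilon>\<close> to both ends, against the triangle
  inequality. Weak properness replaces the two elementary sets by weakly open sets inside them.

  The triangle inequality is only available for points of the space, so the
  argument rests on the projection being a genuine point of the geodesic
  (\<open>geodesic_proj_in_image\<close>). A nearest point exists because \<open>[0,1]\<close> is compact. It is
  unique because, by comparison with a Euclidean isosceles triangle, the midpoint of two distinct
  nearest points would be strictly nearer (\<open>cat0_midpoint_less\<close>).
\<close>

context Metric_space
begin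

lemma geodesic_affine_reparam:
  assumes "geodesic \<gamma>" "s \<in> {0..1}" "t \<in> {0..1}"
  shows "joins (\<lambda>u. \<gamma> (s + u * (t - s))) (\<gamma> s) (\<gamma> t)"
proof -
  have mem: "s + u * (t - s) \<in> {0..1}" if "u \<in> {0..1}" for u
  proof -
    have "closed_segment s t \<subseteq> {0..1}"
      using assms(2,3) by (intro closed_segment_subset) auto
    moreover have "s + u * (t - s) \<in> closed_segment s t"
      using that by (auto simp: in_segment algebra_simps)
    ultimately show ?thesis by blast
  qed
  have speed: "d (\<gamma> a) (\<gamma> b) = \<bar>a - b\<bar> * d (\<gamma> 0) (\<gamma> 1)"
    if "a \<in> {0..1}" "b \<in> {0..1}" for a b
    using assms(1) that unfolding geodesic_def by blast
  have "d (\<gamma> (s + u * (t - s))) (\<gamma> (s + v * (t - s))) = \<bar>u - v\<bar> * d (\<gamma> s) (\<gamma> t)"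
    if "u \<in> {0..1}" "v \<in> {0..1}" for u v
  proof -
    have "\<bar>(s + u * (t - s)) - (s + v * (t - s))\<bar> = \<bar>(u - v) * (t - s)\<bar>"
      by (simp add: algebra_simps)
    also have "\<dots> = \<bar>u - v\<bar> * \<bar>s - t\<bar>" by (simp add: abs_mult abs_minus_commute)
    finally show ?thesis using speed[OF mem[OF that(1)] mem[OF that(2)]] speed[OF assms(2,3)] by simp
  qed
  moreover have "\<gamma> a \<in> M" if "a \<in> {0..1}" for a
    using assms(1) that by (auto simp: geodesic_def)
  ultimately show ?thesis using mem by (auto simp: joins_def geodesic_def Pi_iff)
qed

lemma cat0_midpoint_less:
  assumes cat0 and \<sigma>: "joins \<sigma> p q" and z: "z \<in> M"
    and eq: "d z p = d z q" and ne: "p \<noteq> q"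
  shows "d z (\<sigma> (1/2)) < d z p"
proof -
  have M: "p \<in> M" "q \<in> M" using \<sigma> by (auto simp: joins_def geodesic_def)
  define b where "b = d p q"
  define r where "r = d z p"
  define h where "h = sqrt (r\<^sup>2 - (b/2)\<^sup>2)"
  have b: "0 < b" using M ne by (simp add: b_def)
  have "b \<le> 2 * r" using triangle[OF M(1) z M(2)] eq by (simp add: b_def r_def commute)
  then have br: "(b/2)\<^sup>2 \<le> r\<^sup>2" using b by (intro power_mono) auto
  have r: "0 \<le> r" by (simp add: r_def)
  \<comment> \<open>The comparison triangle, placed so that the midpoint of its base is the origin and its
    apex lies on the second axis.\<close>
  define p' q' z' :: "real ^ 2" where
    "p' = vector [- b/2, 0]" and "q' = vector [b/2, 0]" and "z' = vector [0, h]"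
  have h: "h\<^sup>2 = r\<^sup>2 - (b/2)\<^sup>2" using br by (simp add: h_def)
  have dists: "dist p' q' = d p q" "dist q' z' = d q z" "dist z' p' = d z p"
    using b r h eq
    by (simp_all add: p'_def q'_def z'_def dist_vec_def L2_set_def sum_2 dist_real_def
        flip: b_def r_def commute[of z q])
  obtain \<beta> \<gamma> where \<beta>: "joins \<beta> q z" and \<gamma>: "joins \<gamma> z p"
    using \<open>cat0\<close> M z unfolding cat0_def by meson
  have "let sides = {(\<sigma>, p', q'), (\<beta>, q', z'), (\<gamma>, z', p')} in
          \<forall>(\<sigma>, a, b)\<in>sides. \<forall>(\<tau>, c, e)\<in>sides. \<forall>s\<in>{0..1}. \<forall>t\<in>{0..1}.
            d (\<sigma> s) (\<tau> t) \<le> dist (linepath a b s) (linepath c e t)"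
    using \<open>cat0\<close> M z \<sigma> \<beta> \<gamma> dists unfolding cat0_def by blast
  then have "\<forall>s\<in>{0..1}. \<forall>t\<in>{0..1}. d (\<sigma> s) (\<beta> t) \<le> dist (linepath p' q' s) (linepath q' z' t)"
    unfolding Let_def by simp
  then have "d (\<sigma> (1/2)) (\<beta> 1) \<le> dist (linepath p' q' (1/2)) (linepath q' z' 1)"
    by (elim ballE[where x = "1/2"] ballE[where x = 1]) auto
  also have "\<dots> = h"
    using br by (simp add: linepath_def p'_def q'_def z'_def dist_vec_def L2_set_def sum_2 h_def)
  also have "h < r"
    using b r br by (simp add: h_def real_less_lsqrt)
  finally show ?thesis using \<beta> by (simp add: joins_def commute r_def)
qed

lemma continuous_on_dist_geodesic:
  assumes "geodesic \<gamma>" "z \<in> M"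
  shows "continuous_on {0..1} (\<lambda>t. d z (\<gamma> t))"
proof -
  have mem: "\<gamma> a \<in> M" if "a \<in> {0..1}" for a
    using assms(1) that by (auto simp: geodesic_def)
  have "(d (\<gamma> 0) (\<gamma> 1))-lipschitz_on {0..1} (\<lambda>t. d z (\<gamma> t))"
  proof (rule lipschitz_onI)
    fix s t :: real assume st: "s \<in> {0..1}" "t \<in> {0..1}"
    have "\<bar>d z (\<gamma> s) - d z (\<gamma> t)\<bar> \<le> d (\<gamma> s) (\<gamma> t)"
      using triangle[of z "\<gamma> s" "\<gamma> t"] triangle[of z "\<gamma> t" "\<gamma> s"] assms(2) mem st
      by (simp add: commute abs_le_iff)
    also have "\<dots> = \<bar>s - t\<bar> * d (\<gamma> 0) (\<gamma> 1)"
      using assms(1) st unfolding geodesic_def by blast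
    finally show "dist (d z (\<gamma> s)) (d z (\<gamma> t)) \<le> d (\<gamma> 0) (\<gamma> 1) * dist s t"
      by (simp add: dist_real_def mult.commute)
  qed simp
  then show ?thesis by (rule lipschitz_on_continuous_on)
qed

lemma geodesic_proj_in_image:
  assumes cat0 "geodesic \<gamma>" "z \<in> M"
  shows "geodesic_proj \<gamma> z \<in> \<gamma> ` {0..1}"
proof -
  let ?nearest = "is_arg_min (d z) (\<lambda>w. w \<in> \<gamma> ` {0..1})"
  obtain t where "t \<in> {0..1}" "\<forall>s\<in>{0..1}. d z (\<gamma> t) \<le> d z (\<gamma> s)"
    using continuous_attains_inf[OF _ _ continuous_on_dist_geodesic[OF assms(2,3)]] by auto
  then have t: "?nearest (\<gamma> t)" by (auto simp: is_arg_min_linorder)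
  have unique: "p = q" if p: "?nearest p" and q: "?nearest q" for p q
  proof (rule ccontr)
    assume "p \<noteq> q"
    obtain s t where st: "s \<in> {0..1}" "t \<in> {0..1}" "p = \<gamma> s" "q = \<gamma> t"
      using p q unfolding is_arg_min_def by blast
    let ?m = "s + 1/2 * (t - s)"
    have "d z p = d z q" using p q by (auto simp: is_arg_min_linorder intro: antisym)
    then have "d z (\<gamma> ?m) < d z p"
      using cat0_midpoint_less[OF assms(1) geodesic_affine_reparam[OF assms(2) st(1,2)] assms(3)]
        \<open>p \<noteq> q\<close> st by simp
    moreover have "?m \<in> {0..1}" using st(1,2) by (simp add: field_simps)
    ultimately show False using p unfolding is_arg_min_def by blast
  qed
  have "?nearest (geodesic_proj \<gamma> z)"
    unfolding geodesic_proj_def using t by (rule theI) (rule unique[OF _ t])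
  then show ?thesis by (simp add: is_arg_min_def)
qed

lemma elementary_sets_at_endpoints_disjoint:
  assumes cat0 and \<gamma>: "joins \<gamma> x y" and \<gamma>': "joins \<gamma>' y x"
    and image: "\<gamma>' ` {0..1} = \<gamma> ` {0..1}" and le: "\<epsilon> + \<delta> \<le> d x y"
  shows "disjnt (elementary_set x \<epsilon> \<gamma>) (elementary_set y \<delta> \<gamma>')"
proof -
  have False if z: "z \<in> M" "d x (geodesic_proj \<gamma> z) < \<epsilon>" "d y (geodesic_proj \<gamma>' z) < \<delta>" for z
  proof -
    have "geodesic_proj \<gamma>' z = geodesic_proj \<gamma> z" by (simp add: geodesic_proj_def image)
    moreover have "geodesic_proj \<gamma> z \<in> M"
    proof -
      have "geodesic \<gamma>" using \<gamma> by (simp add: joins_def)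
      moreover from this have "\<gamma> ` {0..1} \<subseteq> M" by (auto simp: geodesic_def)
      ultimately show ?thesis using geodesic_proj_in_image[OF \<open>cat0\<close> _ z(1)] by blast
    qed
    moreover have "x \<in> M" "y \<in> M" using \<gamma> by (auto simp: joins_def geodesic_def)
    ultimately show False using triangle[of x "geodesic_proj \<gamma> z" y] z le by (simp add: commute)
  qed
  then show ?thesis by (auto simp: disjnt_iff elementary_set_def)
qed

lemma Hausdorff_weak_topology:
  assumes cat0 weakly_proper
  shows "Hausdorff_space weak_topology"
  unfolding Hausdorff_space_def topspace_weak_topology
proof (intro allI impI)
  fix x y assume xy: "x \<in> M \<and> y \<in> M \<and> x \<noteq> y"
  obtain \<gamma> where \<gamma>: "joins \<gamma> x y" using \<open>cat0\<close> xy unfolding cat0_def by blast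
  define \<gamma>' where "\<gamma>' = (\<lambda>t. \<gamma> (1 - t))"
  have \<gamma>': "joins \<gamma>' y x"
    using geodesic_affine_reparam[of \<gamma> 1 0] \<gamma> by (simp add: \<gamma>'_def joins_def)
  have "(\<lambda>t. 1 - t) ` {0..1::real} = {0..1}" by simp
  then have image: "\<gamma>' ` {0..1} = \<gamma> ` {0..1}"
    unfolding \<gamma>'_def by (metis image_image)
  have pos: "0 < d x y / 2" using xy by simp
  have "\<gamma> \<in> geodesics_from x" "\<gamma>' \<in> geodesics_from y"
    using \<gamma> \<gamma>' by (auto simp: joins_def geodesics_from_def)
  then obtain U V where
    U: "openin weak_topology U" "x \<in> U" "U \<subseteq> elementary_set x (d x y / 2) \<gamma>" and
    V: "openin weak_topology V" "y \<in> V" "V \<subseteq> elementary_set y (d x y / 2) \<gamma>'"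
    using \<open>weakly_proper\<close> xy pos unfolding weakly_proper_def by meson
  have "disjnt U V"
    using elementary_sets_at_endpoints_disjoint[OF \<open>cat0\<close> \<gamma> \<gamma>' image, of "d x y / 2" "d x y / 2"] U(3) V(3)
    by (auto simp: disjnt_iff)
  with U V show "\<exists>U V. openin weak_topology U \<and> openin weak_topology V \<and> x \<in> U \<and> y \<in> V \<and> disjnt U V"
    by blast
qed

end

theorem lemma2:
  fixes H :: "'a set" and d :: "'a \<Rightarrow> 'a \<Rightarrow> real"
  assumes "Hadamard_space H d"
    and "Metric_space.weakly_proper H d"
  shows "Hausdorff_space (Metric_space.weak_topology H d)"
proof -
  interpret Hadamard_space H d by fact
  show ?thesis using cat0 assms(2) by (rule Hausdorff_weak_topology)
qed

end
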